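(* Let $(x^*,X^* )$ be an optimal solution of problem (DNNP). If $X^*=x^*(x^* )^T$, then $\mathrm{Opt(DNNP)}=\mathrm{Opt(CP)}$, and moreover $(x^*,X^* )$ is an optimal solution of problem (CP).
   Context: Data: positive integers $n,m,p$; symmetric matrices $Q_1,\dots,Q_p\in\mathbb{R}^{n\times n}$ that are not positive semidefinite; vectors $c_1,\dots,c_p\in\mathbb{R}^n$; a matrix $A\in\mathbb{R}^{m\times n}$ and a vector $b\in\mathbb{R}^m$; weights $\lambda=(\lambda_1,\dots,\lambda_p)$ with $\lambda_i\ge 0$ for all $i$ and $\sum_{i=1}^p\lambda_i=1$. Notation: for matrices $M,N$ of the same size, $M\bullet N=\mathrm{trace}(M^TN)$; $\mathrm{diag}(M)$ is the column vector of diagonal entries of $M$; $b\circ b$ is the componentwise product, with $i$-th entry $b_i^2$. $S_k^+$ is the cone of $k\times k$ real symmetric positive semidefinite matrices; $(S_k)^+$ is the cone of $k\times k$ real symmetric matrices with nonnegative entries; $C_k^*$ is the cone of $k\times k$ completely positive matrices, i.e. matrices of the form $VV^T$ where $V$ is an entrywise nonnegative matrix with $k$ rows and finitely many columns (equivalently, the zero matrix and finite sums $\sum_{j} z^j(z^j)^T$ with $z^j\in\mathbb{R}^k$ nonzero and entrywise nonnegative). Problem (CP), in the variables $x\in\mathbb{R}^n$ and $X\in\mathbb{R}^{n\times n}$: minimize $\sum_{i=1}^p\lambda_i(Q_i\bullet X+2c_i^Tx)$ subject to $Ax=b$, $\mathrm{diag}(AXA^T)=b\circ b$, and $\begin{pmatrix}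 1 & x^T \\ x & X \end{pmatrix}\in C_{1+n}^*$. Problem (DNNP), in the same variables: minimize $\sum_{i=1}^p\lambda_i(Q_i\bullet X+2c_i^Tx)$ subject to $Ax=b$, $\mathrm{diag}(AXA^T)=b\circ b$, and $\begin{pmatrix} 1 & x^T \\ x & X \end{pmatrix}\in S_{1+n}^+\cap(S_{1+n})^+$. $\mathrm{Opt}(\cdot)$ denotes the optimal objective value of a problem. *)

theory Defs
  imports "HOL-Analysis.Analysis"
begin

definition frob :: "real^'n^'m \<Rightarrow> real^'n^'m \<Rightarrow> real" (infixl "\<bullet>\<^sub>F" 70)
  where "M \<bullet>\<^sub>F N = trace (transpose M ** N)"

definition diag_vec :: "real^'k^'k \<Rightarrow> real^'k"
  where "diag_vec M = (\<chi> i. M $ i $ i)"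

definition outer :: "real^'k \<Rightarrow> real^'k^'k"
  where "outer x = (\<chi> i j. x $ i * x $ j)"

text \<open>The order \<open>1 + n\<close> is encoded by the index type \<^typ>\<open>'n option\<close>: the index \<^term>\<open>None\<close> is the
  distinguished first row and column of the matrix with blocks \<open>1, x\<^sup>T, x, X\<close>.\<close>

definition bordered :: "real^'n \<Rightarrow> real^'n^'n \<Rightarrow> real^('n option)^('n option)"
  where "bordered x X = (\<chi> r s. case r of
            None \<Rightarrow> (case s of None \<Rightarrow> 1 | Some j \<Rightarrow> x $ j)
          | Some i \<Rightarrow> (case s of None \<Rightarrow> x $ i | Some j \<Rightarrow> X $ i $ j))"

definition psd_cone :: "(real^'k^'k) set"
  where "psd_cone = {M. transpose M = M \<and> (\<forall>v. 0 \<le> v \<bullet> (M *v v))}"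

definition nonneg_sym_cone :: "(real^'k^'k) set"
  where "nonneg_sym_cone = {M. transpose M = M \<and> (\<forall>i j. 0 \<le> M $ i $ j)}"

text \<open>The number \<open>q\<close> of columns of the factor \<open>V\<close> varies, so \<open>V\<close> is given by its entries \<open>V i l\<close> with
  \<open>l < q\<close>; the right-hand side is \<open>V V\<^sup>T\<close>. The case \<open>q = 0\<close> gives the zero matrix.\<close>

definition cp_cone :: "(real^'k^'k) set"
  where "cp_cone = {M. \<exists>(q::nat) (V :: 'k \<Rightarrow> nat \<Rightarrow> real).
            (\<forall>i. \<forall>l<q. 0 \<le> V i l) \<and> M = (\<chi> i j. \<Sum>l<q. V i l * V j l)}"

text \<open>The product of vectors in \<open>b * b\<close> is the componentwise one.\<close>

definition feasible ::
    "(real^('n option)^('n option)) set \<Rightarrow> real^'n^'m \<Rightarrow> real^'m \<Rightarrow> ((real^'n) \<times> (real^'n^'n)) set"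
  where "feasible K A b = {(x, X). A *v x = b \<and> diag_vec (A ** X ** transpose A) = b * b
            \<and> bordered x X \<in> K}"

abbreviation CP_feasible :: "real^'n^'m \<Rightarrow> real^'m \<Rightarrow> ((real^'n) \<times> (real^'n^'n)) set"
  where "CP_feasible \<equiv> feasible cp_cone"

abbreviation DNNP_feasible :: "real^'n^'m \<Rightarrow> real^'m \<Rightarrow> ((real^'n) \<times> (real^'n^'n)) set"
  where "DNNP_feasible \<equiv> feasible (psd_cone \<inter> nonneg_sym_cone)"

definition objective ::
    "('p::finite \<Rightarrow> real) \<Rightarrow> ('p \<Rightarrow> real^'n^'n) \<Rightarrow> ('p \<Rightarrow> real^'n) \<Rightarrow> (real^'n) \<times> (real^'n^'n) \<Rightarrow> real"
  where "objective l Q c = (\<lambda>(x, X). \<Sum>i\<in>UNIV. l i * (Q i \<bullet>\<^sub>F X + 2 * (c i \<bullet> x)))"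

text \<open>The optimal value is an extended real: \<open>\<infinity>\<close> for an infeasible problem and \<open>-\<infinity>\<close> for one that is
  unbounded below.\<close>

definition opt_value :: "('a \<Rightarrow> real) \<Rightarrow> 'a set \<Rightarrow> ereal"
  where "opt_value f F = (INF z\<in>F. ereal (f z))"

definition optimal_solution :: "('a \<Rightarrow> real) \<Rightarrow> 'a set \<Rightarrow> 'a \<Rightarrow> bool"
  where "optimal_solution f F z \<longleftrightarrow> is_arg_min f (\<lambda>y. y \<in> F) z"

end

theory Submission
  imports Defs
begin

text \<open>A completely positive matrix \<open>V V\<^sup>T\<close> is symmetric, entrywise nonnegative and positive
  semidefinite, so (DNNP) is a relaxation of (CP): same objective, larger feasible set. A minimizer
  of a relaxation that happens to be feasible for the original problem is a minimizer of the original
  problem, and both problems then have its objective value as optimal value. It remains to see that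
  the given minimizer is feasible for (CP). The bordered matrix with blocks \<open>1\<close>, \<open>x\<close>, \<open>x\<^sup>T\<close> and
  \<open>x x\<^sup>T\<close> is the rank-one matrix \<open>(1, x) (1, x)\<^sup>T\<close>, and nonnegativity of its first row, which is
  part of feasibility for (DNNP), says that \<open>(1, x)\<close> is itself a nonnegative vector. Hence the
  rank-one factorization already exhibits complete positivity.\<close>

text \<open>The quadratic form of \<open>V V\<^sup>T\<close> is a sum of squares, one for each column of \<open>V\<close>.\<close>

lemma quadratic_form_gram:
  fixes V :: "'k::finite \<Rightarrow> nat \<Rightarrow> real"
  shows "v \<bullet> ((\<chi> i j. \<Sum>l<q. V i l * V j l) *v v) = (\<Sum>l<q. (\<Sum>i\<in>UNIV. v $ i * V i l)\<^sup>2)"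
proof -
  have "v \<bullet> ((\<chi> i j. \<Sum>l<q. V i l * V j l) *v v)
      = (\<Sum>i\<in>UNIV. \<Sum>j\<in>UNIV. \<Sum>l<q. (v $ i * V i l) * (v $ j * V j l))"
    by (simp add: inner_vec_def matrix_vector_mult_def sum_distrib_left sum_distrib_right mult_ac)
  also have "\<dots> = (\<Sum>i\<in>UNIV. \<Sum>l<q. \<Sum>j\<in>UNIV. (v $ i * V i l) * (v $ j * V j l))"
    by (intro sum.cong refl sum.swap)
  also have "\<dots> = (\<Sum>l<q. \<Sum>i\<in>UNIV. \<Sum>j\<in>UNIV. (v $ i * V i l) * (v $ j * V j l))"
    by (rule sum.swap)
  also have "\<dots> = (\<Sum>l<q. (\<Sum>i\<in>UNIV. v $ i * V i l)\<^sup>2)"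
    by (simp add: power2_eq_square sum_product)
  finally show ?thesis .
qed

lemma cp_cone_subset_doubly_nonnegative: "cp_cone \<subseteq> psd_cone \<inter> nonneg_sym_cone"
proof
  fix M :: "real^'k^'k"
  assume "M \<in> cp_cone"
  then obtain q V where V: "\<And>i l. l < q \<Longrightarrow> 0 \<le> V i l"
    and M: "M = (\<chi> i j. \<Sum>l<(q::nat). V i l * V j l)"
    unfolding cp_cone_def by blast
  have "transpose M = M"
    by (simp add: M transpose_def mult.commute)
  moreover have "0 \<le> v \<bullet> (M *v v)" for v
    by (simp add: M quadratic_form_gram sum_nonneg)
  moreover have "0 \<le> M $ i $ j" for i j
    by (auto simp: M intro!: sum_nonneg mult_nonneg_nonneg V)
  ultimately show "M \<in> psd_cone \<inter> nonneg_sym_cone"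
    by (simp add: psd_cone_def nonneg_sym_cone_def)
qed

lemma feasible_mono: "K \<subseteq> L \<Longrightarrow> feasible K A b \<subseteq> feasible L A b"
  by (auto simp: feasible_def)

lemma outer_in_cp_cone:
  assumes "\<And>i. 0 \<le> y $ i"
  shows "outer y \<in> cp_cone"
  unfolding cp_cone_def outer_def
  using assms by (auto intro!: exI[of _ "1::nat"] exI[of _ "\<lambda>i l. y $ i"])

lemma bordered_outer:
  "bordered x (outer x) = outer (\<chi> r. case r of None \<Rightarrow> 1 | Some i \<Rightarrow> x $ i)"
  by (simp add: bordered_def outer_def vec_eq_iff split: option.split)

text \<open>For a rank-one block, entrywise nonnegativity of the bordered matrix is enough for complete
  positivity: its first row contains the generating vector.\<close>

lemma bordered_outer_in_cp_cone:
  assumes "bordered x (outer x) \<in> nonneg_sym_cone"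
  shows "bordered x (outer x) \<in> cp_cone"
proof -
  have "0 \<le> x $ i" for i
  proof -
    have "0 \<le> bordered x (outer x) $ None $ Some i"
      using assms by (simp add: nonneg_sym_cone_def)
    then show ?thesis
      by (simp add: bordered_def)
  qed
  then show ?thesis
    unfolding bordered_outer by (intro outer_in_cp_cone) (simp split: option.split)
qed

lemma optimal_solution_opt_value:
  assumes "optimal_solution f F z"
  shows "opt_value f F = ereal (f z)"
  unfolding opt_value_def
proof (rule antisym)
  show "(INF y\<in>F. ereal (f y)) \<le> ereal (f z)"
    using assms by (intro INF_lower) (simp add: optimal_solution_def is_arg_min_def)
  show "ereal (f z) \<le> (INF y\<in>F. ereal (f y))"
    using assms by (intro INF_greatest) (auto simp: optimal_solution_def is_arg_min_linorder)
qed

lemma optimal_solution_subset: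
  assumes "optimal_solution f F z" and "G \<subseteq> F" and "z \<in> G"
  shows "optimal_solution f G z"
  using assms by (auto simp: optimal_solution_def is_arg_min_def)

theorem theorem4p5:
  fixes Q :: "'p::finite \<Rightarrow> real^'n^'n"
    and c :: "'p \<Rightarrow> real^'n"
    and A :: "real^'n^'m"
    and b :: "real^'m"
    and l :: "'p \<Rightarrow> real"
    and x :: "real^'n"
    and X :: "real^'n^'n"
  assumes "\<And>i. transpose (Q i) = Q i"
    and "\<And>i. Q i \<notin> psd_cone"
    and "\<And>i. 0 \<le> l i"
    and "(\<Sum>i\<in>UNIV. l i) = 1"
    and "optimal_solution (objective l Q c) (DNNP_feasible A b) (x, X)"
    and "X = outer x"
  shows "opt_value (objective l Q c) (DNNP_feasible A b)
           = opt_value (objective l Q c) (CP_feasible A b)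
       \<and> optimal_solution (objective l Q c) (CP_feasible A b) (x, X)"
proof -
  note opt = assms(5)
  have "(x, X) \<in> DNNP_feasible A b"
    using opt by (simp add: optimal_solution_def is_arg_min_def)
  then have "(x, X) \<in> CP_feasible A b"
    using bordered_outer_in_cp_cone[of x] by (simp add: feasible_def \<open>X = outer x\<close>)
  then have "optimal_solution (objective l Q c) (CP_feasible A b) (x, X)"
    by (rule optimal_solution_subset[OF opt feasible_mono[OF cp_cone_subset_doubly_nonnegative]])
  with opt show ?thesis
    by (simp add: optimal_solution_opt_value)
qed

end
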